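(* Let $\mathbb{L}^3$ be $\mathbb{R}^3$ with coordinates $(x,y,z)$ and the metric $g=-2\,dx\,dy+dz^2$. Let $\Omega\subset\mathbb{R}^2$ be a domain and let $\psi:\Omega\to\mathbb{L}^3$, $\psi(y,z)=(u(y,z),y,z)$, be a translation surface, i.e. $u(y,z)=a(y)+b(z)$ for all $(y,z)\in\Omega$, where $a$ and $b$ are smooth functions. If $\psi$ is a translating soliton on the parallel light-like direction $\vec{K}=\vec{x}=(1,0,0)$, then $u$ is one of the following: I. $u(y,z)=-2\lambda^2y+4\lambda^2\log\left(\cosh\left(\frac{z-z_0}{2\lambda}\right)\right)+a_0$, for some $\lambda>0$, $a_0,z_0\in\mathbb{R}$; II. $u(y,z)=a_1e^{-2y}-\frac{b_1^2}{2}y+b_1z+b_0$, for some $a_1,b_1,b_0\in\mathbb{R}$, $a_1\neq0$; III. $u(y,z)=2\lambda^2y-4\lambda^2\log\left|\cos\left(\frac{z-z_0}{2\lambda}\right)\right|+b_0$, for some $\lambda>0$, $b_0,z_0\in\mathbb{R}$; IV. $u(y,z)=-2\lambda^2y+4\lambda^2\log\left|\sinh\left(\frac{z-z_0}{2\lambda}\right)\right|+a_0$, for some $\lambda>0$, $a_0,z_0\in\mathbb{R}$.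
   Context: $\log$ denotes the natural logarithm. A domain is a connected open set. The functions $a$, $b$ are defined on the projections of $\Omega$ to the $y$-axis and $z$-axis respectively. Given a parallel light-like vector $\vec{K}$ in $\mathbb{L}^3$, a non-degenerate immersion $\psi:M\to\mathbb{L}^3$ of a surface (i.e. the induced metric $\psi^*g$ is everywhere non-degenerate, either Riemannian or Lorentzian) is called a translating soliton on the light-like direction $\vec{K}$ if its mean curvature vector $\vec{H}$ satisfies $\vec{H}=\vec{K}^{\perp}$, where $\perp$ is the orthogonal projection on the normal bundle. The mean curvature vector is the (non-normalized) trace $\vec{H}=\mathrm{trace}(\sigma)$, taken with respect to the induced metric, of the second fundamental form $\sigma(X,Y)=(\nabla^o_XY)^{\perp}$, with $\nabla^o$ the Levi-Civita connection of $\mathbb{L}^3$. *)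

theory Defs
  imports "HOL-Analysis.Analysis"
begin

text \<open>Intended for open \<open>S\<close>, since the derivatives are unrestricted ones.\<close>

primrec higher_differentiable_on ::
    "nat \<Rightarrow> 'a::real_normed_vector set \<Rightarrow> ('a \<Rightarrow> 'b::real_normed_vector) \<Rightarrow> bool" where
  "higher_differentiable_on 0 S f \<longleftrightarrow> continuous_on S f"
| "higher_differentiable_on (Suc n) S f \<longleftrightarrow>
     (\<forall>x\<in>S. f differentiable (at x)) \<and>
     (\<forall>v. higher_differentiable_on n S (\<lambda>x. frechet_derivative f (at x) v))"

definition smooth_on ::
    "'a::real_normed_vector set \<Rightarrow> ('a \<Rightarrow> 'b::real_normed_vector) \<Rightarrow> bool" where
  "smooth_on S f \<longleftrightarrow> (\<forall>n. higher_differentiable_on n S f)"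

type_synonym vec3 = "real \<times> real \<times> real"

text \<open>The metric \<open>-2 dx dy + dz\<^sup>2\<close> in coordinates \<open>(x, y, z)\<close>, where \<open>dx dy\<close> is the symmetric
  product, i.e. the quadratic form is \<open>- 2 x y + z\<^sup>2\<close>.\<close>

fun lorentz :: "vec3 \<Rightarrow> vec3 \<Rightarrow> real" where
  "lorentz (x, y, z) (x', y', z') = - (x * y' + y * x') + z * z'"

definition light_like :: "vec3 \<Rightarrow> bool" where
  "light_like v \<longleftrightarrow> v \<noteq> 0 \<and> lorentz v v = 0"

text \<open>Surfaces are given by a parametrization \<open>\<psi>\<close> of an open subset of the plane. Tangent vectors
  at \<open>p\<close> are represented by their coordinates \<open>v\<close> in the parameter plane; \<open>v\<close> stands for
  \<open>d\<psi>\<^sub>p(v)\<close>.\<close>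

definition induced_metric ::
    "(real \<times> real \<Rightarrow> vec3) \<Rightarrow> real \<times> real \<Rightarrow> real \<times> real \<Rightarrow> real \<times> real \<Rightarrow> real" where
  "induced_metric \<psi> p v w =
     lorentz (frechet_derivative \<psi> (at p) v) (frechet_derivative \<psi> (at p) w)"

definition nondegenerate_immersion :: "(real \<times> real) set \<Rightarrow> (real \<times> real \<Rightarrow> vec3) \<Rightarrow> bool" where
  "nondegenerate_immersion M \<psi> \<longleftrightarrow>
     smooth_on M \<psi> \<and>
     (\<forall>p\<in>M. inj (frechet_derivative \<psi> (at p)) \<and>
            (\<forall>v. (\<forall>w. induced_metric \<psi> p v w = 0) \<longrightarrow> v = 0))"

text \<open>Orthogonal projection to the normal space at \<open>p\<close>; the vector \<open>N\<close> exists and is unique where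
  the induced metric is non-degenerate.\<close>

definition normal_part :: "(real \<times> real \<Rightarrow> vec3) \<Rightarrow> real \<times> real \<Rightarrow> vec3 \<Rightarrow> vec3" where
  "normal_part \<psi> p V =
     (THE N. (\<forall>w. lorentz N (frechet_derivative \<psi> (at p) w) = 0) \<and>
             V - N \<in> range (frechet_derivative \<psi> (at p)))"

text \<open>The metric has constant coefficients, so its Levi-Civita connection is the ordinary directional
  derivative. The tangent vector \<open>w\<close> is extended to the field \<open>q \<mapsto> d\<psi>\<^sub>q(w)\<close>;
  the normal part of the derivative does not depend on the extension.\<close>

definition second_fundamental_form ::
    "(real \<times> real \<Rightarrow> vec3) \<Rightarrow> real \<times> real \<Rightarrow> real \<times> real \<Rightarrow> real \<times> real \<Rightarrow> vec3" where
  "second_fundamental_form \<psi> p v w =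
     normal_part \<psi> p
       (frechet_derivative (\<lambda>q. frechet_derivative \<psi> (at q) w) (at p) v)"

text \<open>The trace \<open>\<Sum>\<^sub>i\<^sub>j h\<^sup>i\<^sup>j B(e\<^sub>i, e\<^sub>j)\<close> of a bilinear map \<open>B\<close> with respect to a non-degenerate
  symmetric bilinear form \<open>h\<close>, where \<open>(h\<^sup>i\<^sup>j)\<close> is the inverse of the matrix \<open>(h(e\<^sub>i, e\<^sub>j))\<close>. The vector
  chosen for \<open>e = e\<^sub>i\<close> is \<open>\<Sum>\<^sub>j h\<^sup>i\<^sup>j e\<^sub>j\<close>, the \<open>h\<close>-dual basis vector; the Euclidean inner product only
  serves to express the coordinates of \<open>v\<close>.\<close>

definition metric_trace ::
    "('a::euclidean_space \<Rightarrow> 'a \<Rightarrow> real) \<Rightarrow> ('a \<Rightarrow> 'a \<Rightarrow> 'b::comm_monoid_add) \<Rightarrow> 'b" where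
  "metric_trace h B = (\<Sum>e\<in>Basis. B e (THE w. \<forall>v. h w v = e \<bullet> v))"

definition mean_curvature_vector :: "(real \<times> real \<Rightarrow> vec3) \<Rightarrow> real \<times> real \<Rightarrow> vec3" where
  "mean_curvature_vector \<psi> p =
     metric_trace (induced_metric \<psi> p) (second_fundamental_form \<psi> p)"

definition translating_soliton ::
    "(real \<times> real) set \<Rightarrow> (real \<times> real \<Rightarrow> vec3) \<Rightarrow> vec3 \<Rightarrow> bool" where
  "translating_soliton M \<psi> K \<longleftrightarrow>
     open M \<and> light_like K \<and> nondegenerate_immersion M \<psi> \<and>
     (\<forall>p\<in>M. mean_curvature_vector \<psi> p = normal_part \<psi> p K)"

end

theory Submission
  imports Defs
begin

text \<open>
  Along the translation surface \<open>u = a(y) + b(z)\<close> the tangent vectors are \<open>(a', 1, 0)\<close> and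
  \<open>(b', 0, 1)\<close>, the induced metric has determinant \<open>-(2a' + b'\<^sup>2)\<close>, and \<open>(-a', 1, b')\<close> spans the
  normal line. All second derivatives of the immersion are multiples of the light-like direction
  \<open>(1, 0, 0)\<close>, as is the right-hand side of the soliton condition before projection; comparing
  coefficients of the normal vector turns it into the scalar equation
  \<open>a''(y) + 2 a'(y) = 2 a'(y) b''(z) - b'(z)\<^sup>2\<close>, where \<open>2 a'(y) + b'(z)\<^sup>2 \<noteq> 0\<close> by non-degeneracy
  (lemma \<open>soliton_equation\<close>).

  The variables separate (lemma \<open>separation\<close>). On a rectangle in which \<open>a'\<close> takes two values,
  subtracting two instances of the equation shows that \<open>b''\<close> is constant; then so is \<open>b'\<^sup>2\<close>, and
  therefore \<open>b'' = 0\<close>. On a rectangle in which \<open>a'\<close> is constant, the equation gives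
  \<open>2a' + b'\<^sup>2 = 2a' b''\<close>, so \<open>b''\<close> has no zero by non-degeneracy. Thus \<open>b'' = 0\<close> and \<open>b'' \<noteq> 0\<close> are
  both open conditions on the domain, and connectedness lets just one of them occur, although the
  domain need not be a rectangle.

  What remains are ordinary differential equations on the two projections of the domain, which are
  intervals. If \<open>b'' = 0\<close>, then \<open>b\<close> is affine and \<open>a'' + 2a' = -b'\<^sup>2\<close> is linear with solutions of
  type II. If \<open>a' = c\<close> is constant, then \<open>c \<noteq> 0\<close> and \<open>b'\<close> solves the Riccati equation
  \<open>b'' = 1 + b'\<^sup>2 / (2c)\<close>. For \<open>c = 2\<lambda>\<^sup>2\<close> the solutions are \<open>2\<lambda> tan\<close>, giving type III. For
  \<open>c = -2\<lambda>\<^sup>2\<close> non-degeneracy keeps \<open>b'\<close> away from the stationary values \<open>\<plusminus>2\<lambda>\<close>, so on the whole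
  interval it is either \<open>2\<lambda> tanh\<close> (type I) or \<open>2\<lambda> coth\<close> (type IV).
\<close>

section \<open>From the soliton condition to a scalar equation\<close>

lemma smooth_on_real_second_derivative:
  fixes f :: "real \<Rightarrow> real"
  assumes "smooth_on S f"
  obtains f' f'' where "\<And>x. x \<in> S \<Longrightarrow> (f has_real_derivative f' x) (at x)"
    and "\<And>x. x \<in> S \<Longrightarrow> (f' has_real_derivative f'' x) (at x)"
proof -
  have D: "(g has_real_derivative frechet_derivative g (at x) 1) (at x)"
    if g: "g differentiable (at x)" for g :: "real \<Rightarrow> real" and x
  proof -
    obtain d where "(g has_real_derivative d) (at x)"
      using real_differentiableE[OF g] by blast
    moreover from this have "frechet_derivative g (at x) = (*) d"
      by (metis frechet_derivative_at has_field_derivative_def)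
    ultimately show ?thesis by simp
  qed
  have "higher_differentiable_on (Suc (Suc 0)) S f"
    using assms smooth_on_def by blast
  then have "\<And>x. x \<in> S \<Longrightarrow> f differentiable (at x)"
    and "\<And>x. x \<in> S \<Longrightarrow> (\<lambda>x. frechet_derivative f (at x) 1) differentiable (at x)"
    by auto
  then show thesis
    by (intro that[of "\<lambda>x. frechet_derivative f (at x) 1"
          "\<lambda>x. frechet_derivative (\<lambda>x. frechet_derivative f (at x) 1) (at x) 1"]) (auto intro: D)
qed

text \<open>The normal line of a graph over the \<open>(y, z)\<close>-plane with slopes \<open>s\<close> and \<open>t\<close> is spanned by
  \<open>(-s, 1, t)\<close>, whose Lorentzian square is \<open>2s + t\<^sup>2\<close>. So this line is transversal to the tangent
  plane exactly when \<open>2s + t\<^sup>2\<close> does not vanish. The vectors to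
  project are multiples of \<open>(1, 0, 0)\<close>, namely the soliton direction itself and the second
  derivatives of the graph.\<close>

lemma normal_part_graph:
  assumes d: "frechet_derivative \<psi> (at p) = (\<lambda>v. (s * fst v + t * snd v, v))"
    and W: "2 * s + t\<^sup>2 \<noteq> 0"
  shows "normal_part \<psi> p (c, 0, 0) = (- c / (2 * s + t\<^sup>2)) *\<^sub>R (- s, 1, t)"
  unfolding normal_part_def d
proof (rule the_equality, intro conjI allI)
  fix w :: "real \<times> real"
  show "lorentz ((- c / (2 * s + t\<^sup>2)) *\<^sub>R (- s, 1, t)) (s * fst w + t * snd w, w) = 0"
    by (cases w) (simp add: algebra_simps add_divide_distrib)
next
  define k where "k = c / (2 * s + t\<^sup>2)"
  have "c = k * (2 * s + t\<^sup>2)" using W by (simp add: k_def)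
  then have "(c, 0, 0) - (- k) *\<^sub>R (- s, 1, t) =
      (s * fst (k, k * t) + t * snd (k, k * t), (k, k * t))"
    by (simp add: algebra_simps power2_eq_square)
  then have "(c, 0, 0) - (- c / (2 * s + t\<^sup>2)) *\<^sub>R (- s, 1, t) =
      (s * fst (k, k * t) + t * snd (k, k * t), (k, k * t))"
    by (simp add: k_def)
  then show "(c, 0, 0) - (- c / (2 * s + t\<^sup>2)) *\<^sub>R (- s, 1, t) \<in> range (\<lambda>v. (s * fst v + t * snd v, v))"
    by (metis (no_types, lifting) rangeI)
next
  fix N :: vec3
  assume N: "(\<forall>w. lorentz N (s * fst w + t * snd w, w) = 0) \<and>
    (c, 0, 0) - N \<in> range (\<lambda>v. (s * fst v + t * snd v, v))"
  obtain x y z where xyz: "N = (x, y, z)" by (cases N)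
  have "lorentz N (s, 1, 0) = 0" "lorentz N (t, 0, 1) = 0"
    using N[THEN conjunct1, rule_format, of "(1, 0)"] N[THEN conjunct1, rule_format, of "(0, 1)"] by auto
  then have 1: "x = - y * s" "z = y * t" by (auto simp: xyz algebra_simps)
  have "c - x = - s * y - t * z" using N by (auto simp: xyz)
  then have "y * (2 * s + t\<^sup>2) = - c" using 1 by (simp add: algebra_simps power2_eq_square)
  then have "y = - c / (2 * s + t\<^sup>2)" using W by (simp add: field_simps)
  then show "N = (- c / (2 * s + t\<^sup>2)) *\<^sub>R (- s, 1, t)" using 1 by (simp add: xyz)
qed

text \<open>Raising an index with the inverse metric: the metric has matrix \<open>(-2s, -t; -t, 1)\<close>, with
  determinant \<open>-(2s + t\<^sup>2)\<close>.\<close>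

lemma dual_vector_graph:
  assumes d: "frechet_derivative \<psi> (at p) = (\<lambda>v. (s * fst v + t * snd v, v))"
    and W: "2 * s + t\<^sup>2 \<noteq> 0"
  shows "(THE w. \<forall>v. induced_metric \<psi> p w v = (\<alpha>, \<beta>) \<bullet> v) =
    (- 1 / (2 * s + t\<^sup>2)) *\<^sub>R (\<alpha> + t * \<beta>, t * \<alpha> - 2 * s * \<beta>)"
proof (rule the_equality, intro allI)
  have m: "induced_metric \<psi> p w v =
      (- 2 * s * fst w - t * snd w) * fst v + (snd w - t * fst w) * snd v" for v w
    by (cases v; cases w) (simp add: induced_metric_def d algebra_simps)
  show "induced_metric \<psi> p ((- 1 / (2 * s + t\<^sup>2)) *\<^sub>R (\<alpha> + t * \<beta>, t * \<alpha> - 2 * s * \<beta>)) v = (\<alpha>, \<beta>) \<bullet> v" for v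
    using W by (cases v) (simp add: m divide_simps power2_eq_square, simp add: algebra_simps)
  fix w assume w: "\<forall>v. induced_metric \<psi> p w v = (\<alpha>, \<beta>) \<bullet> v"
  obtain x y where xy: "w = (x, y)" by (cases w)
  have 1: "- 2 * s * x - t * y = \<alpha>" "y - t * x = \<beta>"
    using w[rule_format, of "(1,0)"] w[rule_format, of "(0,1)"] by (auto simp: m xy)
  then have 2: "x * (2 * s + t\<^sup>2) = - (\<alpha> + t * \<beta>)"
    by (auto simp: algebra_simps power2_eq_square)
  have "y * (2 * s + t\<^sup>2) = - (t * \<alpha> - 2 * s * \<beta>)"
    unfolding 1[symmetric] by (auto simp: algebra_simps power2_eq_square)
  with 2 show "w = (- 1 / (2 * s + t\<^sup>2)) *\<^sub>R (\<alpha> + t * \<beta>, t * \<alpha> - 2 * s * \<beta>)"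
    using W by (simp add: xy field_simps)
qed

text \<open>Both sides of the soliton condition are multiples of \<open>(-a', 1, b')\<close>, so its middle
  coordinate contains all the information; it reads \<open>(a'' - 2a' b'') / W\<^sup>2 = -1 / W\<close> with
  \<open>W = 2a' + b'\<^sup>2\<close>.\<close>

lemma soliton_equation:
  assumes sol: "translating_soliton \<Omega> \<psi> (1, 0, 0)"
    and \<psi>: "\<And>y z. (y, z) \<in> \<Omega> \<Longrightarrow> \<psi> (y, z) = (a y + b z, y, z)"
    and a': "\<And>y. y \<in> fst ` \<Omega> \<Longrightarrow> (a has_real_derivative a' y) (at y)"
    and a'': "\<And>y. y \<in> fst ` \<Omega> \<Longrightarrow> (a' has_real_derivative a'' y) (at y)"
    and b': "\<And>z. z \<in> snd ` \<Omega> \<Longrightarrow> (b has_real_derivative b' z) (at z)"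
    and b'': "\<And>z. z \<in> snd ` \<Omega> \<Longrightarrow> (b' has_real_derivative b'' z) (at z)"
    and p: "(y, z) \<in> \<Omega>"
  shows "2 * a' y + (b' z)\<^sup>2 \<noteq> 0"
    and "a'' y + 2 * a' y = 2 * a' y * b'' z - (b' z)\<^sup>2"
proof -
  have "open \<Omega>" and nd: "nondegenerate_immersion \<Omega> \<psi>"
    and H: "mean_curvature_vector \<psi> (y, z) = normal_part \<psi> (y, z) (1, 0, 0)"
    using sol p by (auto simp: translating_soliton_def)
  have along_fst: "((\<lambda>q. f (fst q)) has_derivative (\<lambda>v. f' * fst v)) (at q)"
    if "(f has_real_derivative f') (at (fst q))" for f f' and q :: "real \<times> real"
    by (rule has_derivative_compose[OF has_derivative_fst[OF has_derivative_ident]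
          that[unfolded has_field_derivative_def]])
  have along_snd: "((\<lambda>q. f (snd q)) has_derivative (\<lambda>v. f' * snd v)) (at q)"
    if "(f has_real_derivative f') (at (snd q))" for f f' and q :: "real \<times> real"
    by (rule has_derivative_compose[OF has_derivative_snd[OF has_derivative_ident]
          that[unfolded has_field_derivative_def]])
  \<comment> \<open>The immersion is only prescribed on \<open>\<Omega>\<close>, so its derivatives are computed
    by transfer from the global formula, using that \<open>\<Omega>\<close> is open.\<close>
  have d: "frechet_derivative \<psi> (at q) = (\<lambda>v. (a' (fst q) * fst v + b' (snd q) * snd v, v))"
    if q: "q \<in> \<Omega>" for q
  proof (rule frechet_derivative_at[symmetric], rule has_derivative_transform_within_open[OF _ \<open>open \<Omega>\<close> q])
    show "((\<lambda>q. (a (fst q) + b (snd q), q)) has_derivative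
        (\<lambda>v. (a' (fst q) * fst v + b' (snd q) * snd v, v))) (at q)"
      using q by (intro has_derivative_Pair has_derivative_add has_derivative_ident
          along_fst[OF a'] along_snd[OF b']) auto
    show "(a (fst q) + b (snd q), q) = \<psi> q" if "q \<in> \<Omega>" for q
      using \<psi>[of "fst q" "snd q"] that by simp
  qed
  have d2: "frechet_derivative (\<lambda>q. frechet_derivative \<psi> (at q) w) (at (y, z)) v =
      (a'' y * fst v * fst w + b'' z * snd v * snd w, 0, 0)" for v w
  proof -
    have "((\<lambda>q. frechet_derivative \<psi> (at q) w) has_derivative
        (\<lambda>v. (a'' y * fst v * fst w + b'' z * snd v * snd w, 0))) (at (y, z))"
    proof (rule has_derivative_transform_within_open[OF _ \<open>open \<Omega>\<close> p])
      show "((\<lambda>q. (a' (fst q) * fst w + b' (snd q) * snd w, w)) has_derivative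
          (\<lambda>v. (a'' y * fst v * fst w + b'' z * snd v * snd w, 0))) (at (y, z))"
        using a''[of y] b''[of z] p
        by (intro has_derivative_Pair has_derivative_add has_derivative_const
            has_derivative_mult_left along_fst along_snd) force+
    qed (simp add: d)
    then show ?thesis
      by (simp add: frechet_derivative_at[symmetric] zero_prod_def)
  qed
  note dp = d[OF p, unfolded fst_conv snd_conv]
  show W: "2 * a' y + (b' z)\<^sup>2 \<noteq> 0"
  proof
    assume 0: "2 * a' y + (b' z)\<^sup>2 = 0"
    \<comment> \<open>The vector \<open>(1, b')\<close> spans the radical of the metric when its determinant vanishes.\<close>
    have "induced_metric \<psi> (y, z) (1, b' z) w = - (2 * a' y + (b' z)\<^sup>2) * fst w" for w
      by (cases w) (simp add: induced_metric_def dp algebra_simps power2_eq_square)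
    then have "(1, b' z) = (0 :: real \<times> real)"
      using nd p 0 unfolding nondegenerate_immersion_def by (metis minus_zero mult_zero_left)
    then show False by (simp add: zero_prod_def)
  qed
  have N: "normal_part \<psi> (y, z) (c, 0, 0) = (- c / (2 * a' y + (b' z)\<^sup>2)) *\<^sub>R (- a' y, 1, b' z)" for c
    by (rule normal_part_graph[OF dp W])
  have "fst (snd (mean_curvature_vector \<psi> (y, z))) =
      (a'' y - 2 * a' y * b'' z) / (2 * a' y + (b' z)\<^sup>2)\<^sup>2"
  proof -
    have Basis: "Basis = {(1, 0), (0, 1) :: real \<times> real}" by (auto simp: Basis_prod_def)
    have sum2: "sum f {(1, 0), (0, 1)} = f (1, 0) + f (0, 1)" for f :: "real \<times> real \<Rightarrow> vec3"
      by simp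
    have "mean_curvature_vector \<psi> (y, z) =
        second_fundamental_form \<psi> (y, z) (1, 0) ((- 1 / (2 * a' y + (b' z)\<^sup>2)) *\<^sub>R (1, b' z)) +
        second_fundamental_form \<psi> (y, z) (0, 1) ((- 1 / (2 * a' y + (b' z)\<^sup>2)) *\<^sub>R (b' z, - (2 * a' y)))"
      unfolding mean_curvature_vector_def metric_trace_def Basis
      by (simp only: sum2 dual_vector_graph[OF dp W] mult_zero_right mult_1_right
          add_0_left add_0_right diff_0 diff_0_right)
    then show ?thesis
      unfolding second_fundamental_form_def d2 N
      using W by (simp add: divide_simps power2_eq_square)
  qed
  also have "fst (snd (mean_curvature_vector \<psi> (y, z))) = - 1 / (2 * a' y + (b' z)\<^sup>2)"
    unfolding H N by simp
  finally have "a'' y - 2 * a' y * b'' z = - (2 * a' y + (b' z)\<^sup>2)"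
    using W by (simp add: nonzero_divide_eq_eq nonzero_eq_divide_eq power2_eq_square[of "2 * a' y + _"])
  then show "a'' y + 2 * a' y = 2 * a' y * b'' z - (b' z)\<^sup>2" by simp
qed

section \<open>Separation of the variables\<close>

text \<open>The local argument needs a rectangle, whereas the conclusion is about the full projections of
  a domain that need not be one. The sets \<open>U\<close> and \<open>V\<close> in the proof bridge this: the local
  alternative makes both open, and they are told apart by whether \<open>b''\<close> vanishes.\<close>

lemma separation:
  fixes a' a'' b' b'' :: "real \<Rightarrow> real"
  assumes "open \<Omega>" and "connected \<Omega>"
    and a'': "\<And>y. y \<in> fst ` \<Omega> \<Longrightarrow> (a' has_real_derivative a'' y) (at y)"
    and b'': "\<And>z. z \<in> snd ` \<Omega> \<Longrightarrow> (b' has_real_derivative b'' z) (at z)"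
    and W: "\<And>y z. (y, z) \<in> \<Omega> \<Longrightarrow> 2 * a' y + (b' z)\<^sup>2 \<noteq> 0"
    and eq: "\<And>y z. (y, z) \<in> \<Omega> \<Longrightarrow> a'' y + 2 * a' y = 2 * a' y * b'' z - (b' z)\<^sup>2"
  shows "(\<forall>z\<in>snd ` \<Omega>. b'' z = 0) \<or> (\<forall>y\<in>fst ` \<Omega>. a'' y = 0)"
proof -
  have local: "\<exists>I J. open I \<and> open J \<and> p \<in> I \<times> J \<and> I \<times> J \<subseteq> \<Omega> \<and>
      ((\<forall>z\<in>J. b'' z = 0) \<or> (\<forall>y\<in>I. a'' y = 0) \<and> (\<forall>z\<in>J. b'' z \<noteq> 0))"
    if p: "p \<in> \<Omega>" for p
  proof -
    obtain I J where IJ: "open I" "open J" "p \<in> I \<times> J" "I \<times> J \<subseteq> \<Omega>"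
      by (rule open_prod_elim[OF \<open>open \<Omega>\<close> p])
    obtain y0 z0 where p_eq: "p = (y0, z0)" by (cases p)
    then have y0: "y0 \<in> I" and z0: "z0 \<in> J" using IJ(3) by auto
    have in_\<Omega>: "(y, z) \<in> \<Omega>" if "y \<in> I" "z \<in> J" for y z
      using IJ(4) that by blast
    have "(\<forall>z\<in>J. b'' z = 0) \<or> (\<forall>y\<in>I. a'' y = 0) \<and> (\<forall>z\<in>J. b'' z \<noteq> 0)"
    proof (cases "\<forall>y\<in>I. a' y = a' y0")
      case True
      have a0: "a'' y = 0" if "y \<in> I" for y
      proof -
        have "(a' has_real_derivative a'' y) (at y)" using a''[of y] in_\<Omega>[OF that z0] by force
        moreover have "(a' has_real_derivative 0) (at y)"
          by (rule has_field_derivative_transform_within_open[OF DERIV_const IJ(1) that])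
            (use True in auto)
        ultimately show ?thesis by (rule DERIV_unique)
      qed
      moreover have "b'' z \<noteq> 0" if "z \<in> J" for z
      proof
        assume "b'' z = 0"
        then show False
          using eq[OF in_\<Omega>[OF y0 that]] W[OF in_\<Omega>[OF y0 that]] a0[OF y0] by auto
      qed
      ultimately show ?thesis by blast
    next
      case False
      then obtain y1 where y1: "y1 \<in> I" "a' y1 \<noteq> a' y0" by blast
      define k where "k = (a'' y1 + 2 * a' y1 - a'' y0 - 2 * a' y0) / (2 * (a' y1 - a' y0))"
      have k: "b'' z = k" if "z \<in> J" for z
      proof -
        have "2 * (a' y1 - a' y0) * b'' z = a'' y1 + 2 * a' y1 - a'' y0 - 2 * a' y0"
          using eq[OF in_\<Omega>[OF y0 that]] eq[OF in_\<Omega>[OF y1(1) that]] by (simp add: algebra_simps)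
        then show ?thesis using y1 by (simp add: k_def field_simps)
      qed
      have bk: "b' z * k = 0" if z: "z \<in> J" for z
      proof -
        have D: "(b' has_real_derivative k) (at w)" if "w \<in> J" for w
          using b''[of w] k[OF that] in_\<Omega>[OF y0 that] by force
        \<comment> \<open>Fixing \<open>y0\<close> in the equation shows that \<open>b'\<^sup>2\<close> is constant too.\<close>
        have "((\<lambda>w. (b' w)\<^sup>2) has_real_derivative 2 * b' z * k) (at z)"
          using D[OF z] by (auto intro!: derivative_eq_intros)
        moreover have "((\<lambda>w. (b' w)\<^sup>2) has_real_derivative 0) (at z)"
        proof (rule has_field_derivative_transform_within_open[OF _ IJ(2) z])
          show "((\<lambda>_. 2 * a' y0 * k - a'' y0 - 2 * a' y0) has_real_derivative 0) (at z)" by simp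
          show "2 * a' y0 * k - a'' y0 - 2 * a' y0 = (b' w)\<^sup>2" if "w \<in> J" for w
            using eq[OF in_\<Omega>[OF y0 that]] k[OF that] by simp
        qed
        ultimately have "2 * b' z * k = 0" by (rule DERIV_unique)
        then show ?thesis by simp
      qed
      have "k = 0"
      proof (rule ccontr)
        assume "k \<noteq> 0"
        have "(b' has_real_derivative 0) (at z0)"
          by (rule has_field_derivative_transform_within_open[OF _ IJ(2) z0, of "\<lambda>_. 0"])
            (use bk \<open>k \<noteq> 0\<close> in auto)
        moreover have "(b' has_real_derivative k) (at z0)"
          using b''[of z0] k[OF z0] in_\<Omega>[OF y0 z0] by force
        ultimately have "0 = k" by (rule DERIV_unique)
        with \<open>k \<noteq> 0\<close> show False by simp
      qed
      then show ?thesis using k by simp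
    qed
    then show ?thesis using IJ by blast
  qed
  define U where "U = {p \<in> \<Omega>. b'' (snd p) = 0}"
  define V where "V = {p \<in> \<Omega>. a'' (fst p) = 0 \<and> b'' (snd p) \<noteq> 0}"
  have "open U"
  proof (subst open_subopen, rule ballI)
    fix p assume "p \<in> U"
    then have "p \<in> \<Omega>" "b'' (snd p) = 0" by (auto simp: U_def)
    from local[OF this(1)] obtain I J where IJ: "open I" "open J" "p \<in> I \<times> J" "I \<times> J \<subseteq> \<Omega>"
      "(\<forall>z\<in>J. b'' z = 0) \<or> (\<forall>y\<in>I. a'' y = 0) \<and> (\<forall>z\<in>J. b'' z \<noteq> 0)"
      by blast
    moreover have "snd p \<in> J" using IJ(3) by auto
    ultimately have "\<forall>z\<in>J. b'' z = 0" using \<open>b'' (snd p) = 0\<close> by blast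
    then have "I \<times> J \<subseteq> U" using IJ(4) by (auto simp: U_def)
    then show "\<exists>T. open T \<and> p \<in> T \<and> T \<subseteq> U"
      using open_Times[OF IJ(1,2)] IJ(3) by blast
  qed
  moreover have "open V"
  proof (subst open_subopen, rule ballI)
    fix p assume "p \<in> V"
    then have "p \<in> \<Omega>" "b'' (snd p) \<noteq> 0" by (auto simp: V_def)
    from local[OF this(1)] obtain I J where IJ: "open I" "open J" "p \<in> I \<times> J" "I \<times> J \<subseteq> \<Omega>"
      "(\<forall>z\<in>J. b'' z = 0) \<or> (\<forall>y\<in>I. a'' y = 0) \<and> (\<forall>z\<in>J. b'' z \<noteq> 0)"
      by blast
    moreover have "snd p \<in> J" using IJ(3) by auto
    ultimately have "\<forall>y\<in>I. a'' y = 0" "\<forall>z\<in>J. b'' z \<noteq> 0" using \<open>b'' (snd p) \<noteq> 0\<close> by blast+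
    then have "I \<times> J \<subseteq> V" using IJ(4) by (auto simp: V_def)
    then show "\<exists>T. open T \<and> p \<in> T \<and> T \<subseteq> V"
      using open_Times[OF IJ(1,2)] IJ(3) by blast
  qed
  moreover have "\<Omega> \<subseteq> U \<union> V"
  proof
    fix p assume "p \<in> \<Omega>"
    from local[OF this] obtain I J where "p \<in> I \<times> J"
      "(\<forall>z\<in>J. b'' z = 0) \<or> (\<forall>y\<in>I. a'' y = 0) \<and> (\<forall>z\<in>J. b'' z \<noteq> 0)"
      by blast
    then have "b'' (snd p) = 0 \<or> a'' (fst p) = 0 \<and> b'' (snd p) \<noteq> 0" by auto
    with \<open>p \<in> \<Omega>\<close> show "p \<in> U \<union> V" by (simp add: U_def V_def)
  qed
  moreover have "U \<inter> V \<inter> \<Omega> = {}" by (auto simp: U_def V_def)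
  ultimately have "U \<inter> \<Omega> = {} \<or> V \<inter> \<Omega> = {}"
    using connectedD[OF \<open>connected \<Omega>\<close>] by blast
  with \<open>\<Omega> \<subseteq> U \<union> V\<close> have "\<Omega> \<subseteq> V \<or> \<Omega> \<subseteq> U" by blast
  then show ?thesis by (auto simp: U_def V_def)
qed

section \<open>Riccati equations on an interval\<close>

lemma equal_derivatives_differ_by_constant:
  fixes f g :: "real \<Rightarrow> real"
  assumes "convex S"
    and "\<And>x. x \<in> S \<Longrightarrow> (f has_real_derivative f' x) (at x)"
    and "\<And>x. x \<in> S \<Longrightarrow> (g has_real_derivative f' x) (at x)"
  shows "\<exists>c. \<forall>x\<in>S. f x = g x + c"
proof -
  have "\<exists>c. \<forall>x\<in>S. f x - g x = c"
    using assms(2,3) by (intro has_field_derivative_zero_constant[OF \<open>convex S\<close>])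
      (auto intro!: derivative_eq_intros intro: has_field_derivative_at_within)
  then show ?thesis by (metis diff_add_cancel add.commute)
qed

lemma DERIV_ln_abs:
  fixes f :: "real \<Rightarrow> real"
  assumes "(f has_real_derivative D) (at x)" and "f x \<noteq> 0"
  shows "((\<lambda>x. ln \<bar>f x\<bar>) has_real_derivative D / f x) (at x)"
proof -
  \<comment> \<open>Squaring removes the absolute value without a case distinction on the sign.\<close>
  have "(\<lambda>x. ln \<bar>f x\<bar>) = (\<lambda>x. ln ((f x)\<^sup>2) / 2)"
  proof
    fix x
    have "ln ((f x)\<^sup>2) = ln (\<bar>f x\<bar>\<^sup>2)" by simp
    also have "\<dots> = 2 * ln \<bar>f x\<bar>" unfolding ln_realpow by simp
    finally show "ln \<bar>f x\<bar> = ln ((f x)\<^sup>2) / 2" by simp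
  qed
  moreover have "((\<lambda>x. ln ((f x)\<^sup>2) / 2) has_real_derivative (1 / (f x)\<^sup>2 * (2 * f x * D)) / 2) (at x)"
    using assms by (auto intro!: derivative_eq_intros)
  ultimately show ?thesis using assms(2) by (simp add: power2_eq_square)
qed

lemma tanh_artanh_real:
  assumes "\<bar>x\<bar> < (1::real)"
  shows "tanh (artanh x) = x"
proof -
  have "exp (- 2 * artanh x) = (1 - x) / (1 + x)"
    using assms by (simp add: artanh_def exp_minus)
  then have "tanh (artanh x) = (1 - (1 - x) / (1 + x)) / (1 + (1 - x) / (1 + x))"
    by (simp only: tanh_real_altdef)
  also have "\<dots> = x" using assms by (simp add: divide_simps)
  finally show ?thesis .
qed

text \<open>Dividing by \<open>1 - g\<^sup>2\<close> turns the equation into \<open>(artanh g)' = 1/m\<close>.\<close>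

lemma riccati_tanh:
  fixes g :: "real \<Rightarrow> real"
  assumes S: "convex S"
    and g: "\<And>x. x \<in> S \<Longrightarrow> (g has_real_derivative (1 - (g x)\<^sup>2) / m) (at x)"
    and lt: "\<And>x. x \<in> S \<Longrightarrow> \<bar>g x\<bar> < 1"
    and m: "m > 0"
  obtains x0 where "\<And>x. x \<in> S \<Longrightarrow> g x = tanh ((x - x0) / m)"
proof -
  have nz: "(g x)\<^sup>2 \<noteq> 1" if "x \<in> S" for x
    using lt[OF that] by (auto simp: power2_eq_1_iff)
  have D: "((\<lambda>x. artanh (g x)) has_real_derivative 1 / m) (at x)" if "x \<in> S" for x
  proof -
    have "((\<lambda>x. artanh (g x)) has_real_derivative (1 / (1 - (g x)\<^sup>2)) * ((1 - (g x)\<^sup>2) / m)) (at x)"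
      by (rule DERIV_chain2[OF artanh_real_has_field_derivative g[OF that]]) (use lt[OF that] in auto)
    then show ?thesis using nz[OF that] by simp
  qed
  have D': "((\<lambda>x. x / m) has_real_derivative 1 / m) (at x)" for x
    using m by (auto intro!: derivative_eq_intros)
  obtain c where c: "\<And>x. x \<in> S \<Longrightarrow> artanh (g x) = x / m + c"
    using equal_derivatives_differ_by_constant[OF S D D'] by blast
  have "g x = tanh ((x - - m * c) / m)" if "x \<in> S" for x
    using tanh_artanh_real[OF lt[OF that]] c[OF that] m by (simp add: field_simps)
  then show thesis by (rule that)
qed

text \<open>Here \<open>(arctan g)' = 1/m\<close>. The linear argument of the tangent is a value of \<open>arctan\<close>, so it
  stays within one branch, away from the zeros of the cosine.\<close>

lemma riccati_tan:
  fixes g :: "real \<Rightarrow> real"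
  assumes S: "convex S"
    and g: "\<And>x. x \<in> S \<Longrightarrow> (g has_real_derivative (1 + (g x)\<^sup>2) / m) (at x)"
    and m: "m > 0"
  obtains x0 where "\<And>x. x \<in> S \<Longrightarrow> g x = tan ((x - x0) / m) \<and> cos ((x - x0) / m) \<noteq> 0"
proof -
  have D: "((\<lambda>x. arctan (g x)) has_real_derivative 1 / m) (at x)" if "x \<in> S" for x
  proof -
    have "((\<lambda>x. arctan (g x)) has_real_derivative inverse (1 + (g x)\<^sup>2) * ((1 + (g x)\<^sup>2) / m)) (at x)"
      by (rule DERIV_chain2[OF DERIV_arctan g[OF that]])
    moreover have "1 + (g x)\<^sup>2 \<noteq> 0" by (metis sum_power2_eq_zero_iff one_power2 zero_neq_one)
    ultimately show ?thesis by (simp add: field_simps)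
  qed
  have D': "((\<lambda>x. x / m) has_real_derivative 1 / m) (at x)" for x
    using m by (auto intro!: derivative_eq_intros)
  obtain c where c: "\<And>x. x \<in> S \<Longrightarrow> arctan (g x) = x / m + c"
    using equal_derivatives_differ_by_constant[OF S D D'] by blast
  have "(x - - m * c) / m = arctan (g x)" if "x \<in> S" for x
    using c[OF that] m by (simp add: field_simps)
  then show thesis by (intro that[of "- m * c"]) (simp add: tan_arctan)
qed


text \<open>A solution that avoids the stationary values \<open>\<plusminus>1\<close> stays, by the intermediate value theorem,
  in \<open>\<bar>g\<bar> < 1\<close> or in \<open>\<bar>g\<bar> > 1\<close>. The equation is invariant under \<open>g \<mapsto> 1/g\<close>, which
  reduces the second case to the first.\<close>

lemma riccati_tanh_or_coth:
  fixes g :: "real \<Rightarrow> real"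
  assumes S: "convex S"
    and g: "\<And>x. x \<in> S \<Longrightarrow> (g has_real_derivative (1 - (g x)\<^sup>2) / m) (at x)"
    and ne: "\<And>x. x \<in> S \<Longrightarrow> (g x)\<^sup>2 \<noteq> 1"
    and m: "m > 0"
  obtains (tanh) x0 where "\<And>x. x \<in> S \<Longrightarrow> g x = tanh ((x - x0) / m)"
    | (coth) x0 where "\<And>x. x \<in> S \<Longrightarrow> sinh ((x - x0) / m) \<noteq> 0 \<and>
        g x = cosh ((x - x0) / m) / sinh ((x - x0) / m)"
proof -
  have "continuous_on S (\<lambda>x. \<bar>g x\<bar>)"
    using g by (intro continuous_on_rabs DERIV_continuous_on) (auto intro: has_field_derivative_at_within)
  then have conn: "connected ((\<lambda>x. \<bar>g x\<bar>) ` S)"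
    using S by (intro connected_continuous_image convex_connected)
  have ne': "1 \<notin> (\<lambda>x. \<bar>g x\<bar>) ` S"
  proof
    assume "1 \<in> (\<lambda>x. \<bar>g x\<bar>) ` S"
    then obtain x where "x \<in> S" "\<bar>g x\<bar> = 1" by auto
    then show False using ne[of x] by (metis one_power2 power2_abs)
  qed
  show thesis
  proof (cases "\<forall>x\<in>S. \<bar>g x\<bar> < 1")
    case True
    then have lt: "\<bar>g x\<bar> < 1" if "x \<in> S" for x using that by blast
    show thesis using riccati_tanh[OF S g lt m] tanh by blast
  next
    case False
    then obtain x1 where "x1 \<in> S" "\<bar>g x1\<bar> \<ge> 1" by force
    then have gt: "\<bar>g x\<bar> > 1" if "x \<in> S" for x
      using connectedD_interval[OF conn, of "\<bar>g x\<bar>" "\<bar>g x1\<bar>" 1] ne' that by force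
    have D: "((\<lambda>x. inverse (g x)) has_real_derivative (1 - (inverse (g x))\<^sup>2) / m) (at x)" if "x \<in> S" for x
    proof -
      have "g x \<noteq> 0" using gt[OF that] by auto
      then show ?thesis using m
        by (auto intro!: derivative_eq_intros g[OF that] simp: field_simps power2_eq_square)
    qed
    have lt: "\<bar>inverse (g x)\<bar> < 1" if "x \<in> S" for x
      using gt[OF that] by (simp add: field_simps)
    obtain x0 where x0: "\<And>x. x \<in> S \<Longrightarrow> inverse (g x) = tanh ((x - x0) / m)"
      using riccati_tanh[OF S D lt m] by blast
    have "sinh ((x - x0) / m) \<noteq> 0 \<and> g x = cosh ((x - x0) / m) / sinh ((x - x0) / m)"
      if "x \<in> S" for x
    proof -
      have gi: "g x = inverse (tanh ((x - x0) / m))" using x0[OF that] by (metis inverse_inverse_eq)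
      moreover have "g x \<noteq> 0" using gt[OF that] by auto
      ultimately have "sinh ((x - x0) / m) \<noteq> 0" by (auto simp: tanh_def)
      then show ?thesis by (simp add: gi tanh_def)
    qed
    then show thesis by (rule coth)
  qed
qed

section \<open>The profile functions\<close>

text \<open>The name refers to the slope \<open>a' = -2\<mu>\<^sup>2\<close> of the other summand. After scaling by \<open>2\<mu>\<close> the
  derivative \<open>b'\<close> solves the equation of \<open>tanh\<close> and \<open>coth\<close>, whose primitives are \<open>ln cosh\<close> and
  \<open>ln \<bar>sinh\<bar>\<close>.\<close>

lemma profile_negative_slope:
  fixes b :: "real \<Rightarrow> real"
  assumes S: "convex S"
    and b': "\<And>z. z \<in> S \<Longrightarrow> (b has_real_derivative b' z) (at z)"
    and b'': "\<And>z. z \<in> S \<Longrightarrow> (b' has_real_derivative 1 - (b' z)\<^sup>2 / (4 * \<mu>\<^sup>2)) (at z)"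
    and ne: "\<And>z. z \<in> S \<Longrightarrow> (b' z)\<^sup>2 \<noteq> 4 * \<mu>\<^sup>2"
    and "\<mu> > 0"
  obtains (cosh) z0 c where "\<And>z. z \<in> S \<Longrightarrow> b z = 4 * \<mu>\<^sup>2 * ln (cosh ((z - z0) / (2 * \<mu>))) + c"
    | (sinh) z0 c where "\<And>z. z \<in> S \<Longrightarrow> sinh ((z - z0) / (2 * \<mu>)) \<noteq> 0 \<and>
        b z = 4 * \<mu>\<^sup>2 * ln \<bar>sinh ((z - z0) / (2 * \<mu>))\<bar> + c"
proof -
  define g where "g z = b' z / (2 * \<mu>)" for z
  have b'_eq: "b' z = 2 * \<mu> * g z" for z using \<open>\<mu> > 0\<close> by (simp add: g_def)
  have g: "(g has_real_derivative (1 - (g z)\<^sup>2) / (2 * \<mu>)) (at z)" if "z \<in> S" for z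
    unfolding g_def using \<open>\<mu> > 0\<close> b''[OF that]
    by (auto intro!: derivative_eq_intros simp: field_simps power2_eq_square)
  have g1: "(g z)\<^sup>2 \<noteq> 1" if "z \<in> S" for z
    using ne[OF that] by (auto simp: b'_eq power_mult_distrib)
  show thesis
  proof (rule riccati_tanh_or_coth[OF S g g1])
    fix z0 assume z0: "\<And>z. z \<in> S \<Longrightarrow> g z = tanh ((z - z0) / (2 * \<mu>))"
    have "((\<lambda>z. 4 * \<mu>\<^sup>2 * ln (cosh ((z - z0) / (2 * \<mu>)))) has_real_derivative b' z) (at z)"
      if "z \<in> S" for z
      unfolding b'_eq z0[OF that] using \<open>\<mu> > 0\<close>
      by (auto intro!: derivative_eq_intros simp: tanh_def field_simps power2_eq_square)
    from equal_derivatives_differ_by_constant[OF S b' this] show thesis using cosh by blast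
  next
    fix z0 assume z0: "\<And>z. z \<in> S \<Longrightarrow> sinh ((z - z0) / (2 * \<mu>)) \<noteq> 0 \<and>
      g z = cosh ((z - z0) / (2 * \<mu>)) / sinh ((z - z0) / (2 * \<mu>))"
    have "((\<lambda>z. 4 * \<mu>\<^sup>2 * ln \<bar>sinh ((z - z0) / (2 * \<mu>))\<bar>) has_real_derivative b' z) (at z)"
      if "z \<in> S" for z
    proof -
      have "((\<lambda>z. sinh ((z - z0) / (2 * \<mu>))) has_real_derivative cosh ((z - z0) / (2 * \<mu>)) / (2 * \<mu>)) (at z)"
        using \<open>\<mu> > 0\<close> by (auto intro!: derivative_eq_intros)
      from DERIV_cmult[OF DERIV_ln_abs[OF this], of "4 * \<mu>\<^sup>2"] show ?thesis
        using z0[OF that] \<open>\<mu> > 0\<close> by (simp add: b'_eq power2_eq_square mult.assoc)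
    qed
    from equal_derivatives_differ_by_constant[OF S b' this] obtain c
      where "\<And>z. z \<in> S \<Longrightarrow> b z = 4 * \<mu>\<^sup>2 * ln \<bar>sinh ((z - z0) / (2 * \<mu>))\<bar> + c" by blast
    with z0 show thesis by (intro sinh) auto
  qed (use \<open>\<mu> > 0\<close> in auto)
qed

text \<open>The counterpart for the slope \<open>a' = 2\<mu>\<^sup>2\<close>.\<close>

lemma profile_positive_slope:
  fixes b :: "real \<Rightarrow> real"
  assumes S: "convex S"
    and b': "\<And>z. z \<in> S \<Longrightarrow> (b has_real_derivative b' z) (at z)"
    and b'': "\<And>z. z \<in> S \<Longrightarrow> (b' has_real_derivative 1 + (b' z)\<^sup>2 / (4 * \<mu>\<^sup>2)) (at z)"
    and "\<mu> > 0"
  obtains z0 c where "\<And>z. z \<in> S \<Longrightarrow> cos ((z - z0) / (2 * \<mu>)) \<noteq> 0 \<and>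
        b z = - 4 * \<mu>\<^sup>2 * ln \<bar>cos ((z - z0) / (2 * \<mu>))\<bar> + c"
proof -
  define g where "g z = b' z / (2 * \<mu>)" for z
  have b'_eq: "b' z = 2 * \<mu> * g z" for z using \<open>\<mu> > 0\<close> by (simp add: g_def)
  have g: "(g has_real_derivative (1 + (g z)\<^sup>2) / (2 * \<mu>)) (at z)" if "z \<in> S" for z
    unfolding g_def using \<open>\<mu> > 0\<close> b''[OF that]
    by (auto intro!: derivative_eq_intros simp: field_simps power2_eq_square)
  obtain z0 where z0: "\<And>z. z \<in> S \<Longrightarrow> g z = tan ((z - z0) / (2 * \<mu>)) \<and> cos ((z - z0) / (2 * \<mu>)) \<noteq> 0"
    using riccati_tan[OF S g] \<open>\<mu> > 0\<close> by auto
  have "((\<lambda>z. - 4 * \<mu>\<^sup>2 * ln \<bar>cos ((z - z0) / (2 * \<mu>))\<bar>) has_real_derivative b' z) (at z)"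
    if "z \<in> S" for z
  proof -
    have "((\<lambda>z. cos ((z - z0) / (2 * \<mu>))) has_real_derivative - sin ((z - z0) / (2 * \<mu>)) / (2 * \<mu>)) (at z)"
      using \<open>\<mu> > 0\<close> by (auto intro!: derivative_eq_intros)
    from DERIV_cmult[OF DERIV_ln_abs[OF this], of "- 4 * \<mu>\<^sup>2"] show ?thesis
      using z0[OF that] \<open>\<mu> > 0\<close> by (simp add: b'_eq tan_def power2_eq_square mult.assoc)
  qed
  from equal_derivatives_differ_by_constant[OF S b' this] obtain c
    where "\<And>z. z \<in> S \<Longrightarrow> b z = - 4 * \<mu>\<^sup>2 * ln \<bar>cos ((z - z0) / (2 * \<mu>))\<bar> + c" by blast
  with z0 show thesis by (intro that) auto
qed

text \<open>The linear equation \<open>a'' + 2a' = -k\<close>, solved with the integrating factor \<open>e\<^sup>2\<^sup>y\<close>. The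
  formula for \<open>a'\<close> is recorded as well, because non-degeneracy, a condition on \<open>a'\<close>, is what
  excludes \<open>c = 0\<close>.\<close>

lemma profile_exponential:
  fixes a :: "real \<Rightarrow> real"
  assumes S: "convex S"
    and a': "\<And>y. y \<in> S \<Longrightarrow> (a has_real_derivative a' y) (at y)"
    and a'': "\<And>y. y \<in> S \<Longrightarrow> (a' has_real_derivative - k - 2 * a' y) (at y)"
  obtains c d where "\<And>y. y \<in> S \<Longrightarrow> a' y = - 2 * c * exp (- 2 * y) - k / 2"
    and "\<And>y. y \<in> S \<Longrightarrow> a y = c * exp (- 2 * y) - k / 2 * y + d"
proof -
  have "((\<lambda>y. (a' y + k / 2) * exp (2 * y)) has_real_derivative 0) (at y within S)" if "y \<in> S" for y
    using has_field_derivative_at_within[OF a''[OF that]]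
    by (auto intro!: derivative_eq_intros simp: algebra_simps)
  from has_field_derivative_zero_constant[OF S this] obtain e where e: "\<And>y. y \<in> S \<Longrightarrow> (a' y + k / 2) * exp (2 * y) = e"
    by blast
  define c where "c = - e / 2"
  have ca: "a' y = - 2 * c * exp (- 2 * y) - k / 2" if "y \<in> S" for y
    using e[OF that, symmetric] by (simp add: c_def exp_minus field_simps)
  have "((\<lambda>y. c * exp (- 2 * y) - k / 2 * y) has_real_derivative a' y) (at y)" if "y \<in> S" for y
    unfolding ca[OF that] by (auto intro!: derivative_eq_intros)
  from equal_derivatives_differ_by_constant[OF S a' this] ca show thesis using that by blast
qed

section \<open>The classification\<close>

theorem theorem3p1:
  fixes \<Omega> :: "(real \<times> real) set" and u :: "real \<times> real \<Rightarrow> real" and a b :: "real \<Rightarrow> real"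
  assumes "open \<Omega>" and "connected \<Omega>"
    and "smooth_on (fst ` \<Omega>) a" and "smooth_on (snd ` \<Omega>) b"
    and "\<forall>(y, z)\<in>\<Omega>. u (y, z) = a y + b z"
    and "translating_soliton \<Omega> (\<lambda>(y, z). (u (y, z), y, z)) (1, 0, 0)"
  shows
    "(\<exists>lam>0. \<exists>a\<^sub>0 z\<^sub>0. \<forall>(y, z)\<in>\<Omega>.
        u (y, z) = - 2 * lam\<^sup>2 * y + 4 * lam\<^sup>2 * ln (cosh ((z - z\<^sub>0) / (2 * lam))) + a\<^sub>0) \<or>
     (\<exists>a\<^sub>1 b\<^sub>1 b\<^sub>0. a\<^sub>1 \<noteq> 0 \<and> (\<forall>(y, z)\<in>\<Omega>.
        u (y, z) = a\<^sub>1 * exp (- 2 * y) - b\<^sub>1\<^sup>2 / 2 * y + b\<^sub>1 * z + b\<^sub>0)) \<or>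
     (\<exists>lam>0. \<exists>b\<^sub>0 z\<^sub>0. \<forall>(y, z)\<in>\<Omega>.
        cos ((z - z\<^sub>0) / (2 * lam)) \<noteq> 0 \<and>
        u (y, z) = 2 * lam\<^sup>2 * y - 4 * lam\<^sup>2 * ln \<bar>cos ((z - z\<^sub>0) / (2 * lam))\<bar> + b\<^sub>0) \<or>
     (\<exists>lam>0. \<exists>a\<^sub>0 z\<^sub>0. \<forall>(y, z)\<in>\<Omega>.
        sinh ((z - z\<^sub>0) / (2 * lam)) \<noteq> 0 \<and>
        u (y, z) = - 2 * lam\<^sup>2 * y + 4 * lam\<^sup>2 * ln \<bar>sinh ((z - z\<^sub>0) / (2 * lam))\<bar> + a\<^sub>0)"
    (is "?I \<or> ?II \<or> ?III \<or> ?IV")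
proof (cases "\<Omega> = {}")
  case True
  \<comment> \<open>A connected set may be empty here, and then any choice of parameters works.\<close>
  then show ?thesis by (auto intro: exI[of _ 1])
next
  case False
  then obtain y0 z0 where p0: "(y0, z0) \<in> \<Omega>" by auto
  have u: "u (y, z) = a y + b z" if "(y, z) \<in> \<Omega>" for y z
    using assms(5) that by auto
  let ?A = "fst ` \<Omega>" and ?B = "snd ` \<Omega>"
  have "convex ?A" "convex ?B"
    unfolding is_interval_convex_1[symmetric] is_interval_connected_1
    by (intro connected_continuous_image continuous_intros \<open>connected \<Omega>\<close>)+
  have proj: "y \<in> ?A" "z \<in> ?B" if "(y, z) \<in> \<Omega>" for y z
    using that by force+
  obtain a' a'' where a': "\<And>y. y \<in> ?A \<Longrightarrow> (a has_real_derivative a' y) (at y)"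
    and a'': "\<And>y. y \<in> ?A \<Longrightarrow> (a' has_real_derivative a'' y) (at y)"
    using smooth_on_real_second_derivative[OF assms(3)] by blast
  obtain b' b'' where b': "\<And>z. z \<in> ?B \<Longrightarrow> (b has_real_derivative b' z) (at z)"
    and b'': "\<And>z. z \<in> ?B \<Longrightarrow> (b' has_real_derivative b'' z) (at z)"
    using smooth_on_real_second_derivative[OF assms(4)] by blast
  have W: "2 * a' y + (b' z)\<^sup>2 \<noteq> 0"
    and eq: "a'' y + 2 * a' y = 2 * a' y * b'' z - (b' z)\<^sup>2" if "(y, z) \<in> \<Omega>" for y z
    using soliton_equation[OF assms(6) _ a' a'' b' b'' that] u by auto
  from separation[OF assms(1,2) a'' b'' W eq]
  show ?thesis
  proof
    assume b0: "\<forall>z\<in>?B. b'' z = 0"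
    have "(b' has_real_derivative 0) (at z within ?B)" if "z \<in> ?B" for z
      using has_field_derivative_at_within[OF b''[OF that]] b0 that by simp
    from has_field_derivative_zero_constant[OF \<open>convex ?B\<close> this] obtain \<beta> where \<beta>: "\<And>z. z \<in> ?B \<Longrightarrow> b' z = \<beta>"
      by blast
    have "((\<lambda>z. \<beta> * z) has_real_derivative b' z) (at z)" if "z \<in> ?B" for z
      unfolding \<beta>[OF that] by (auto intro!: derivative_eq_intros)
    from equal_derivatives_differ_by_constant[OF \<open>convex ?B\<close> b' this]
    obtain d where d: "\<And>z. z \<in> ?B \<Longrightarrow> b z = \<beta> * z + d" by blast
    have "(a' has_real_derivative - \<beta>\<^sup>2 - 2 * a' y) (at y)" if y: "y \<in> ?A" for y
    proof -
      obtain z where yz: "(y, z) \<in> \<Omega>" using y by auto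
      then have "a'' y = - \<beta>\<^sup>2 - 2 * a' y" using eq[OF yz] \<beta>[OF proj(2)[OF yz]] b0 proj[OF yz] by simp
      then show ?thesis using a''[OF y] by simp
    qed
    note a_ode = this
    obtain c e where c: "\<And>y. y \<in> ?A \<Longrightarrow> a' y = - 2 * c * exp (- 2 * y) - \<beta>\<^sup>2 / 2"
      and e: "\<And>y. y \<in> ?A \<Longrightarrow> a y = c * exp (- 2 * y) - \<beta>\<^sup>2 / 2 * y + e"
      using profile_exponential[OF \<open>convex ?A\<close> a' a_ode] by blast
    \<comment> \<open>For \<open>c = 0\<close> the determinant term \<open>2a' + \<beta>\<^sup>2\<close> would vanish identically.\<close>
    have "c \<noteq> 0"
      using W[OF p0] c[OF proj(1)[OF p0]] \<beta>[OF proj(2)[OF p0]] by auto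
    moreover have "u (y, z) = c * exp (- 2 * y) - \<beta>\<^sup>2 / 2 * y + \<beta> * z + (e + d)"
      if "(y, z) \<in> \<Omega>" for y z
      using u[OF that] e[OF proj(1)[OF that]] d[OF proj(2)[OF that]] by simp
    ultimately have ?II by blast
    then show ?thesis by blast
  next
    assume a0: "\<forall>y\<in>?A. a'' y = 0"
    have "(a' has_real_derivative 0) (at y within ?A)" if "y \<in> ?A" for y
      using has_field_derivative_at_within[OF a''[OF that]] a0 that by simp
    from has_field_derivative_zero_constant[OF \<open>convex ?A\<close> this] obtain c where c: "\<And>y. y \<in> ?A \<Longrightarrow> a' y = c"
      by blast
    have "((\<lambda>y. c * y) has_real_derivative a' y) (at y)" if "y \<in> ?A" for y
      unfolding c[OF that] by (auto intro!: derivative_eq_intros)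
    from equal_derivatives_differ_by_constant[OF \<open>convex ?A\<close> a' this]
    obtain d where d: "\<And>y. y \<in> ?A \<Longrightarrow> a y = c * y + d" by blast
    have Wc: "2 * c + (b' z)\<^sup>2 \<noteq> 0" and eqc: "2 * c = 2 * c * b'' z - (b' z)\<^sup>2" if z: "z \<in> ?B" for z
    proof -
      obtain y where yz: "(y, z) \<in> \<Omega>" using z by auto
      show "2 * c + (b' z)\<^sup>2 \<noteq> 0" "2 * c = 2 * c * b'' z - (b' z)\<^sup>2"
        using W[OF yz] eq[OF yz] c[OF proj(1)[OF yz]] a0 proj[OF yz] by auto
    qed
    \<comment> \<open>For \<open>c = 0\<close> the equation gives \<open>b' = 0\<close>, which is degenerate.\<close>
    have "c \<noteq> 0" using Wc[OF proj(2)[OF p0]] eqc[OF proj(2)[OF p0]] by auto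
    define lam where "lam = sqrt (\<bar>c\<bar> / 2)"
    have lam: "lam > 0" "2 * lam\<^sup>2 = \<bar>c\<bar>" using \<open>c \<noteq> 0\<close> by (auto simp: lam_def)
    show ?thesis
    proof (cases "c < 0")
      case True
      then have cl: "c = - 2 * lam\<^sup>2" using lam by simp
      have D: "(b' has_real_derivative 1 - (b' z)\<^sup>2 / (4 * lam\<^sup>2)) (at z)" if "z \<in> ?B" for z
      proof -
        have "b'' z = 1 - (b' z)\<^sup>2 / (4 * lam\<^sup>2)"
          using eqc[OF that] lam(1) by (simp add: cl field_simps)
        then show ?thesis using b''[OF that] by simp
      qed
      have ne: "(b' z)\<^sup>2 \<noteq> 4 * lam\<^sup>2" if "z \<in> ?B" for z
        using Wc[OF that] by (simp add: cl)
      show ?thesis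
      proof (rule profile_negative_slope[OF \<open>convex ?B\<close> b' D ne lam(1)])
        fix z1 e assume e: "\<And>z. z \<in> ?B \<Longrightarrow> b z = 4 * lam\<^sup>2 * ln (cosh ((z - z1) / (2 * lam))) + e"
        have "u (y, z) =
            - 2 * lam\<^sup>2 * y + 4 * lam\<^sup>2 * ln (cosh ((z - z1) / (2 * lam))) + (d + e)" if "(y, z) \<in> \<Omega>" for y z
          using u[OF that] d[OF proj(1)[OF that]] e[OF proj(2)[OF that]] by (simp add: cl)
        then have ?I by (intro exI[of _ lam] conjI lam(1) exI[of _ "d + e"] exI[of _ z1]) blast
        then show ?thesis by blast
      next
        fix z1 e assume e: "\<And>z. z \<in> ?B \<Longrightarrow> sinh ((z - z1) / (2 * lam)) \<noteq> 0 \<and>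
          b z = 4 * lam\<^sup>2 * ln \<bar>sinh ((z - z1) / (2 * lam))\<bar> + e"
        have "sinh ((z - z1) / (2 * lam)) \<noteq> 0 \<and> u (y, z) =
            - 2 * lam\<^sup>2 * y + 4 * lam\<^sup>2 * ln \<bar>sinh ((z - z1) / (2 * lam))\<bar> + (d + e)" if "(y, z) \<in> \<Omega>" for y z
          using u[OF that] d[OF proj(1)[OF that]] e[OF proj(2)[OF that]] by (simp add: cl)
        then have ?IV by (intro exI[of _ lam] conjI lam(1) exI[of _ "d + e"] exI[of _ z1]) blast
        then show ?thesis by blast
      qed
    next
      case False
      then have cl: "c = 2 * lam\<^sup>2" using lam by simp
      have D: "(b' has_real_derivative 1 + (b' z)\<^sup>2 / (4 * lam\<^sup>2)) (at z)" if "z \<in> ?B" for z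
      proof -
        have "b'' z = 1 + (b' z)\<^sup>2 / (4 * lam\<^sup>2)"
          using eqc[OF that] lam(1) by (simp add: cl field_simps)
        then show ?thesis using b''[OF that] by simp
      qed
      obtain z1 e where e: "\<And>z. z \<in> ?B \<Longrightarrow> cos ((z - z1) / (2 * lam)) \<noteq> 0 \<and>
          b z = - 4 * lam\<^sup>2 * ln \<bar>cos ((z - z1) / (2 * lam))\<bar> + e"
        using profile_positive_slope[OF \<open>convex ?B\<close> b' D lam(1)] by blast
      have "cos ((z - z1) / (2 * lam)) \<noteq> 0 \<and> u (y, z) =
          2 * lam\<^sup>2 * y - 4 * lam\<^sup>2 * ln \<bar>cos ((z - z1) / (2 * lam))\<bar> + (d + e)" if "(y, z) \<in> \<Omega>" for y z
        using u[OF that] d[OF proj(1)[OF that]] e[OF proj(2)[OF that]] by (simp add: cl)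
      then have ?III by (intro exI[of _ lam] conjI lam(1) exI[of _ "d + e"] exI[of _ z1]) blast
      then show ?thesis by blast
    qed
  qed
qed

end
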